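(* Let $d$ be a positive integer and let $K$ be a set of $k$ positive integers. Then $$n_r(K,d)\le 2^{k-1}\binom{d}{k}+2^{k-1}\binom{d-1}{k}+2^k-1.$$
   Context: All graphs are finite and simple. A biclique of a graph $G$ is a complete bipartite subgraph of $G$; it is given by two disjoint vertex classes $X,Y\subseteq V(G)$ such that every vertex of $X$ is adjacent in $G$ to every vertex of $Y$, its edges being all pairs $xy$ with $x\in X$, $y\in Y$ (a class may be empty). A biclique cover of $G$ is a collection (indexed family, repetitions allowed) of bicliques of $G$ such that every edge of $G$ belongs to at least one of them; the number of bicliques in the collection is its size. For a set $K$ of positive integers, a biclique cover of $G$ is of type $K$ if for every edge $e$ of $G$ the number of bicliques of the cover that contain $e$ is an element of $K$. A biclique cover $\{G_1,\dots,G_d\}$ of $G$, where $G_i$ has vertex classes $(X_i,Y_i)$, is called regular if $X_i\cup Y_i=V(G)$ for every $1\le i\le d$. The number $n_r(K,d)$ is the maximum number $n$ of vertices of a complete graph $K_n$ that admits a regular biclique cover of type $K$ and size $d$. Here $k\ge 1$, and $\binom{a}{b}=0$ when $b>a\geq 0$. *)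

theory Defs
  imports Complex_Main
begin

record 'a graph =
  verts :: "'a set"
  edges :: "'a set set"

definition simple_graph :: "'a graph \<Rightarrow> bool" where
  "simple_graph G \<longleftrightarrow>
     finite (verts G) \<and> (\<forall>e\<in>edges G. e \<subseteq> verts G \<and> card e = 2)"

definition complete_graph :: "nat \<Rightarrow> nat graph" where
  "complete_graph n = \<lparr>verts = {..<n}, edges = {e. e \<subseteq> {..<n} \<and> card e = 2}\<rparr>"

text \<open>A biclique is represented by its ordered pair of vertex classes; either class may be empty.\<close>

definition biclique :: "'a graph \<Rightarrow> 'a set \<times> 'a set \<Rightarrow> bool" where
  "biclique G B \<longleftrightarrow> (case B of (X, Y) \<Rightarrow>
     X \<subseteq> verts G \<and> Y \<subseteq> verts G \<and> X \<inter> Y = {} \<and>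
     (\<forall>x\<in>X. \<forall>y\<in>Y. {x, y} \<in> edges G))"

definition biclique_edges :: "'a set \<times> 'a set \<Rightarrow> 'a set set" where
  "biclique_edges B = (case B of (X, Y) \<Rightarrow> {{x, y} | x y. x \<in> X \<and> y \<in> Y})"

text \<open>Covers are indexed families with repetitions allowed, hence lists; the size of a cover
  is the length of the list.\<close>

definition biclique_cover :: "'a graph \<Rightarrow> ('a set \<times> 'a set) list \<Rightarrow> bool" where
  "biclique_cover G Bs \<longleftrightarrow>
     (\<forall>B\<in>set Bs. biclique G B) \<and>
     (\<forall>e\<in>edges G. \<exists>B\<in>set Bs. e \<in> biclique_edges B)"

definition cover_multiplicity :: "('a set \<times> 'a set) list \<Rightarrow> 'a set \<Rightarrow> nat" where
  "cover_multiplicity Bs e = card {i. i < length Bs \<and> e \<in> biclique_edges (Bs ! i)}"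

definition cover_of_type :: "nat set \<Rightarrow> 'a graph \<Rightarrow> ('a set \<times> 'a set) list \<Rightarrow> bool" where
  "cover_of_type K G Bs \<longleftrightarrow> (\<forall>e\<in>edges G. cover_multiplicity Bs e \<in> K)"

definition regular_cover :: "'a graph \<Rightarrow> ('a set \<times> 'a set) list \<Rightarrow> bool" where
  "regular_cover G Bs \<longleftrightarrow> (\<forall>(X, Y)\<in>set Bs. X \<union> Y = verts G)"

definition admits_regular_cover :: "nat set \<Rightarrow> nat \<Rightarrow> 'a graph \<Rightarrow> bool" where
  "admits_regular_cover K d G \<longleftrightarrow>
     (\<exists>Bs. length Bs = d \<and> biclique_cover G Bs \<and> cover_of_type K G Bs \<and> regular_cover G Bs)"

text \<open>The maximum exists for all \<open>K\<close> and \<open>d\<close>: see \<open>n_r_attained\<close> and \<open>n_r_upper\<close> below.\<close>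

definition n_r :: "nat set \<Rightarrow> nat \<Rightarrow> nat" where
  "n_r K d = Max {n. admits_regular_cover K d (complete_graph n)}"

lemma simple_graph_complete_graph: "simple_graph (complete_graph n)"
  by (simp add: simple_graph_def complete_graph_def)

lemma admits_regular_cover_complete_graph_1: "admits_regular_cover K d (complete_graph 1)"
proof -
  have no_edges: "edges (complete_graph 1) = {}"
  proof -
    have "card e \<noteq> 2" if "e \<subseteq> {..<1::nat}" for e
      using card_mono[OF _ that] by auto
    then show ?thesis
      by (auto simp: complete_graph_def)
  qed
  have "verts (complete_graph 1) = {..<1}"
    by (simp add: complete_graph_def)
  with no_edges show ?thesis
    unfolding admits_regular_cover_def
    by (intro exI[of _ "replicate d ({..<1}, {})"])
      (auto simp: biclique_cover_def cover_of_type_def regular_cover_def biclique_def)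
qed

lemma admits_regular_cover_complete_graph_le:
  assumes "admits_regular_cover K d (complete_graph n)"
  shows "n \<le> 2 ^ d"
proof -
  obtain Bs where Bs: "length Bs = d" "biclique_cover (complete_graph n) Bs"
    using assms by (auto simp: admits_regular_cover_def)
  define f where "f v = {i. i < d \<and> v \<in> fst (Bs ! i)}" for v
  have "inj_on f {..<n}"
  proof (rule inj_onI, rule ccontr)
    fix u v
    assume uv: "u \<in> {..<n}" "v \<in> {..<n}" "f u = f v" "u \<noteq> v"
    then have "{u, v} \<in> edges (complete_graph n)"
      by (simp add: complete_graph_def)
    then obtain B where B: "B \<in> set Bs" "{u, v} \<in> biclique_edges B"
      using Bs(2) by (auto simp: biclique_cover_def)
    then obtain i where i: "i < d" "Bs ! i = B"
      using Bs(1) by (metis in_set_conv_nth)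
    have "biclique (complete_graph n) B"
      using B(1) Bs(2) by (auto simp: biclique_cover_def)
    then have "u \<in> fst B \<longleftrightarrow> v \<notin> fst B"
      using B(2) by (auto simp: biclique_def biclique_edges_def doubleton_eq_iff)
    then have "i \<in> f u \<longleftrightarrow> i \<notin> f v"
      using i by (simp add: f_def)
    with uv(3) show False
      by simp
  qed
  moreover have "f ` {..<n} \<subseteq> Pow {..<d}"
    by (auto simp: f_def)
  ultimately have "card {..<n} \<le> card (Pow {..<d})"
    by (intro card_inj_on_le) auto
  then show ?thesis
    by (simp add: card_Pow)
qed

lemma finite_admits_regular_cover: "finite {n. admits_regular_cover K d (complete_graph n)}"
  by (rule finite_subset[of _ "{..2 ^ d}"]) (auto dest: admits_regular_cover_complete_graph_le)

lemma n_r_attained: "admits_regular_cover K d (complete_graph (n_r K d))"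
  using Max_in[OF finite_admits_regular_cover, of K d] admits_regular_cover_complete_graph_1[of K d]
  by (auto simp: n_r_def)

lemma n_r_upper: "admits_regular_cover K d (complete_graph n) \<Longrightarrow> n \<le> n_r K d"
  by (simp add: n_r_def finite_admits_regular_cover)

end

theory Submission
  imports Defs "HOL-Library.Function_Algebras"
begin

text \<open>
  Give each vertex \<open>v\<close> the set of indices \<open>i\<close> with \<open>v \<in> X\<^sub>i\<close>. In a regular
  cover every vertex lies in exactly one class of each biclique, so the edge \<open>uv\<close> belongs to the
  \<open>i\<close>-th biclique exactly when \<open>i\<close> is in the symmetric difference of the two index sets: the
  multiplicity of an edge is the Hamming distance between the codes of its ends. A regular cover
  of \<open>K\<^sub>n\<close> of type \<open>K\<close> and size \<open>d\<close> thus yields \<open>n\<close> points of the \<open>d\<close>-dimensional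
  cube whose pairwise distances all lie in \<open>K\<close>
  (\<open>regular_cover_few_distances\<close>).

  Such a family obeys Delsarte's bound \<open>n \<le> (\<Sum>i\<le>k. d choose i)\<close>
  (\<open>few_distances_bound\<close>), by the polynomial method. On the cube, the distance to a fixed point
  is an affine function of the coordinates. Hence the product over \<open>m \<in> K\<close> of \<open>m\<close>
  minus the distance to \<open>B\<close> is a polynomial of degree at most \<open>k\<close>; it vanishes at all
  points of the family other than \<open>B\<close>, but not at \<open>B\<close> itself because \<open>0\<close> is not in
  \<open>K\<close>. The polynomials belonging to the points are therefore linearly independent, while
  coordinates are idempotent on the cube, so that multilinear monomials of degree at most \<open>k\<close>
  span all of them.

  Delsarte's bound in turn lies below the claimed one (\<open>sum_choose_less\<close>): by Pascal's rule,
  going from \<open>d\<close> to \<open>d + 1\<close> raises the sum by the corresponding sum for \<open>k - 1\<close>, and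
  raises the claimed bound by at least the claimed bound for \<open>k - 1\<close> as soon as
  \<open>d \<ge> k\<close>.
\<close>

section \<open>Spaces of real functions\<close>

interpretation fn: vector_space "\<lambda>(c::real) (f::'a \<Rightarrow> real) x. c * f x"
  by unfold_locales (auto simp: fun_eq_iff algebra_simps)

lemma sum_fun_apply: "(\<Sum>i\<in>I. f i) x = (\<Sum>i\<in>I. (f i x :: real))"
  by (induction I rule: infinite_finite_induct) auto

text \<open>The matrix with entries \<open>f i (p j)\<close> is diagonal with nonzero diagonal, so evaluating a linear
  relation among the \<open>f i\<close> at \<open>p i\<close> isolates the coefficient of \<open>f i\<close>. The functions are thus
  independent, and there are at most as many as there are spanning functions.\<close>

lemma card_le_of_dual_points:
  fixes f :: "'i \<Rightarrow> 'a \<Rightarrow> real"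
  assumes "finite B"
    and span: "\<And>i. i \<in> I \<Longrightarrow> f i \<in> fn.span B"
    and diag: "\<And>i. i \<in> I \<Longrightarrow> f i (p i) \<noteq> 0"
    and off_diag: "\<And>i j. i \<in> I \<Longrightarrow> j \<in> I \<Longrightarrow> i \<noteq> j \<Longrightarrow> f i (p j) = 0"
  shows "card I \<le> card B"
proof -
  have inj: "inj_on f I"
    by (rule inj_onI) (metis diag off_diag)
  have "fn.independent (f ` I)"
    unfolding fn.independent_explicit_module
  proof (intro allI impI)
    fix T u v
    assume T: "finite T" "T \<subseteq> f ` I" and zero: "(\<Sum>g\<in>T. (\<lambda>x. u g * g x)) = 0" and "v \<in> T"
    then obtain i where i: "i \<in> I" "v = f i"
      by blast
    have "g (p i) = 0" if "g \<in> T - {v}" for g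
      using that T(2) i off_diag by fastforce
    then have "(\<Sum>g\<in>T. u g * g (p i)) = u v * v (p i)"
      by (subst sum.remove[OF T(1) \<open>v \<in> T\<close>]) (simp add: sum.neutral)
    moreover have "(\<Sum>g\<in>T. u g * g (p i)) = 0"
      using fun_cong[OF zero, of "p i"] by (simp add: sum_fun_apply)
    ultimately show "u v = 0"
      using diag i by simp
  qed
  then have "card (f ` I) \<le> card B"
    using fn.independent_span_bound[OF \<open>finite B\<close>] span by blast
  with inj show ?thesis
    by (simp add: card_image)
qed

section \<open>Families of sets with few pairwise distances\<close>

text \<open>A point of the cube is a set \<open>A\<close>, with the 0-1 indicators of \<open>v \<in> A\<close> as its coordinates. The
  product of the coordinates indexed by \<open>S\<close>, a multilinear monomial, is then the indicator of
  \<open>S \<subseteq> A\<close>.\<close>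

definition monomial :: "'a set \<Rightarrow> 'a set \<Rightarrow> real" where
  "monomial S A = of_bool (S \<subseteq> A)"

definition monomials :: "'a set \<Rightarrow> nat \<Rightarrow> ('a set \<Rightarrow> real) set" where
  "monomials V j = monomial ` {S. S \<subseteq> V \<and> card S \<le> j}"

lemma finite_monomials: "finite V \<Longrightarrow> finite (monomials V j)"
  by (simp add: monomials_def)

lemma card_monomials_le:
  assumes "finite V"
  shows "card (monomials V j) \<le> (\<Sum>i\<le>j. card V choose i)"
proof -
  have "{S. S \<subseteq> V \<and> card S \<le> j} = (\<Union>i\<le>j. {S. S \<subseteq> V \<and> card S = i})"
    by auto
  then have "card {S. S \<subseteq> V \<and> card S \<le> j} \<le> (\<Sum>i\<le>j. card {S. S \<subseteq> V \<and> card S = i})"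
    by (simp add: card_UN_le)
  also have "\<dots> = (\<Sum>i\<le>j. card V choose i)"
    by (simp add: n_subsets[OF assms])
  finally show ?thesis
    unfolding monomials_def
    by (rule order_trans[OF card_image_le, rotated]) (simp add: assms)
qed

lemma span_monomials_mono: "i \<le> j \<Longrightarrow> fn.span (monomials V i) \<subseteq> fn.span (monomials V j)"
  by (rule fn.span_mono) (auto simp: monomials_def)

text \<open>Coordinates are idempotent: multiplying the monomial of \<open>S\<close> by the coordinate \<open>v\<close> gives the
  monomial of \<open>insert v S\<close>, which stays multilinear and has degree at most one larger.\<close>

lemma coordinate_mult_in_span:
  assumes "finite V" "v \<in> V" "f \<in> fn.span (monomials V j)"
  shows "(\<lambda>A. of_bool (v \<in> A) * f A) \<in> fn.span (monomials V (Suc j))"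
  using assms(3)
proof (induction rule: fn.span_induct_alt)
  case base
  then show ?case
    using fn.span_zero by (simp add: zero_fun_def)
next
  case (step c g h)
  then obtain S where S: "g = monomial S" "S \<subseteq> V" "card S \<le> j"
    by (auto simp: monomials_def)
  then have "card (insert v S) \<le> Suc j"
    using finite_subset[OF S(2) \<open>finite V\<close>] by (simp add: card_insert_if)
  with S \<open>v \<in> V\<close> have "monomial (insert v S) \<in> fn.span (monomials V (Suc j))"
    by (intro fn.span_base) (auto simp: monomials_def)
  from fn.span_add[OF fn.span_scale[OF this, of c] step(2)]
  show ?case
    by (rule back_subst[of "\<lambda>x. x \<in> _"]) (auto simp: S monomial_def fun_eq_iff algebra_simps)
qed

lemma affine_mult_in_span:
  assumes "finite V" "f \<in> fn.span (monomials V j)"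
  shows "(\<lambda>A. (a + (\<Sum>v\<in>V. c v * of_bool (v \<in> A))) * f A) \<in> fn.span (monomials V (Suc j))"
proof -
  have "f \<in> fn.span (monomials V (Suc j))"
    using assms(2) span_monomials_mono[of j "Suc j" V] by auto
  then have "(\<lambda>A. a * f A) \<in> fn.span (monomials V (Suc j))"
    by (rule fn.span_scale)
  moreover have "(\<Sum>v\<in>V. (\<lambda>A. c v * (of_bool (v \<in> A) * f A))) \<in> fn.span (monomials V (Suc j))"
    using assms by (intro fn.span_sum fn.span_scale coordinate_mult_in_span)
  ultimately have "(\<lambda>A. a * f A) + (\<Sum>v\<in>V. (\<lambda>A. c v * (of_bool (v \<in> A) * f A)))
      \<in> fn.span (monomials V (Suc j))"
    by (rule fn.span_add)
  then show ?thesis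
    by (rule back_subst[of "\<lambda>x. x \<in> _"])
      (simp add: fun_eq_iff sum_fun_apply distrib_right sum_distrib_right mult.assoc)
qed

text \<open>Starting from the empty set, whose distance to \<open>B\<close> is \<open>card B\<close>, each element put into \<open>A\<close> lowers
  the distance by one if it is in \<open>B\<close> and raises it by one otherwise. Distance is thus affine in the
  coordinates of \<open>A\<close>, so each factor of the distance polynomial costs only one degree.\<close>

lemma card_sym_diff_affine:
  assumes "finite V" "A \<subseteq> V" "B \<subseteq> V"
  shows "real (card (sym_diff A B)) =
    real (card B) + (\<Sum>v\<in>V. (1 - 2 * of_bool (v \<in> B)) * of_bool (v \<in> A))"
proof -
  have card_sum: "real (card C) = (\<Sum>v\<in>V. of_bool (v \<in> C))" if "C \<subseteq> V" for C
    using that assms(1) by (simp add: of_bool_def sum.If_cases inf.absorb2)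
  have "sym_diff A B \<subseteq> V"
    using assms by auto
  then show ?thesis
    by (simp add: card_sum \<open>B \<subseteq> V\<close> flip: sum.distrib) (rule sum.cong, auto)
qed

lemma distance_polynomial_in_span:
  fixes V :: "'a set"
  assumes "finite V" "finite K"
  shows "(\<lambda>A. \<Prod>m\<in>K. real m - (real (card B) + (\<Sum>v\<in>V. (1 - 2 * of_bool (v \<in> B)) * of_bool (v \<in> A))))
    \<in> fn.span (monomials V (card K))"
  using \<open>finite K\<close>
proof (induction K)
  case empty
  have "monomial {} \<in> fn.span (monomials V 0)"
    by (rule fn.span_base) (auto simp: monomials_def)
  then show ?case
    by (simp add: monomial_def[abs_def])
next
  case (insert m K)
  have *: "real m - (real (card B) + (\<Sum>v\<in>V. (1 - 2 * of_bool (v \<in> B)) * of_bool (v \<in> A)))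
      = real m - real (card B) + (\<Sum>v\<in>V. - (1 - 2 * of_bool (v \<in> B)) * of_bool (v \<in> A))" for m A
    by (simp only: sum_negf mult_minus_left)
  show ?case
    unfolding prod.insert[OF insert.hyps] card_insert_disjoint[OF insert.hyps] *
    using affine_mult_in_span[OF \<open>finite V\<close> insert.IH,
        of "real m - real (card B)" "\<lambda>v. - (1 - 2 * of_bool (v \<in> B))"]
    unfolding * .
qed

text \<open>Delsarte's bound: \<open>q B\<close> below is the polynomial whose zeros on the cube are the points at a distance
  in \<open>K\<close> from \<open>B\<close>. Every other member of \<open>F\<close> is such a point, and \<open>B\<close> is not, so these
  polynomials are dual to the points of \<open>F\<close>.\<close>

theorem few_distances_bound:
  fixes V :: "'a set"
  assumes "finite V" "F \<subseteq> Pow V" "finite K" "0 \<notin> K"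
    and dist: "\<And>A B. A \<in> F \<Longrightarrow> B \<in> F \<Longrightarrow> A \<noteq> B \<Longrightarrow> card (sym_diff A B) \<in> K"
  shows "card F \<le> (\<Sum>i\<le>card K. card V choose i)"
proof -
  define q :: "'a set \<Rightarrow> 'a set \<Rightarrow> real" where
    "q B A = (\<Prod>m\<in>K. real m - (real (card B) + (\<Sum>v\<in>V. (1 - 2 * of_bool (v \<in> B)) * of_bool (v \<in> A))))"
    for B A
  have q: "q B A = (\<Prod>m\<in>K. real m - real (card (sym_diff A B)))" if "A \<in> F" "B \<in> F" for A B
    using that assms(2) unfolding q_def
    by (subst card_sym_diff_affine[OF \<open>finite V\<close>]) auto
  have "card F \<le> card (monomials V (card K))"
  proof (rule card_le_of_dual_points[where f = q and p = id])
    show "finite (monomials V (card K))"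
      using \<open>finite V\<close> by (rule finite_monomials)
    show "q B \<in> fn.span (monomials V (card K))" for B
      unfolding q_def by (rule distance_polynomial_in_span[OF \<open>finite V\<close> \<open>finite K\<close>])
    show "q B (id B) \<noteq> 0" if "B \<in> F" for B
      using that \<open>0 \<notin> K\<close> \<open>finite K\<close> by (auto simp: q)
    show "q B (id A) = 0" if "B \<in> F" "A \<in> F" "B \<noteq> A" for A B
      using that dist[of A B] \<open>finite K\<close> by (auto simp: q)
  qed
  also have "\<dots> \<le> (\<Sum>i\<le>card K. card V choose i)"
    using \<open>finite V\<close> by (rule card_monomials_le)
  finally show ?thesis .
qed

section \<open>Regular bicliques as coordinates\<close>

text \<open>Regularity turns each biclique into a 0-1 coordinate defined on all vertices, which separates
  exactly the pairs forming its edges. Distinct vertices get distinct codes since their distance,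
  being in \<open>K\<close>, is positive.\<close>

lemma regular_cover_few_distances:
  assumes "admits_regular_cover K d (complete_graph n)" "0 \<notin> K"
  obtains F where "F \<subseteq> Pow {..<d}" "card F = n"
    "\<And>A B. A \<in> F \<Longrightarrow> B \<in> F \<Longrightarrow> A \<noteq> B \<Longrightarrow> card (sym_diff A B) \<in> K"
proof -
  obtain Bs where Bs: "length Bs = d" "biclique_cover (complete_graph n) Bs"
      "cover_of_type K (complete_graph n) Bs" "regular_cover (complete_graph n) Bs"
    using assms(1) by (auto simp: admits_regular_cover_def)
  define code where "code v = {i. i < d \<and> v \<in> fst (Bs ! i)}" for v
  have dist: "card (sym_diff (code u) (code v)) \<in> K" if uv: "u < n" "v < n" "u \<noteq> v" for u v
  proof -
    have "{u, v} \<in> biclique_edges (Bs ! i) \<longleftrightarrow> (u \<in> fst (Bs ! i) \<longleftrightarrow> v \<notin> fst (Bs ! i))"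
      if "i < d" for i
    proof -
      obtain X Y where XY: "Bs ! i = (X, Y)"
        by fastforce
      have "(X, Y) \<in> set Bs"
        using that Bs(1) XY by (metis nth_mem)
      then have "X \<inter> Y = {}" "X \<union> Y = {..<n}"
        using Bs(2,4)
        by (auto simp: biclique_cover_def biclique_def regular_cover_def complete_graph_def)
      then have "u \<in> X \<union> Y" "v \<in> X \<union> Y" "X \<inter> Y = {}"
        using uv by auto
      then show ?thesis
        by (auto simp: XY biclique_edges_def doubleton_eq_iff)
    qed
    then have "{i. i < d \<and> {u, v} \<in> biclique_edges (Bs ! i)} = sym_diff (code u) (code v)"
      by (auto simp: code_def)
    moreover have "{u, v} \<in> edges (complete_graph n)"
      using uv by (simp add: complete_graph_def)
    then have "cover_multiplicity Bs {u, v} \<in> K"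
      using Bs(3) by (auto simp: cover_of_type_def)
    ultimately show ?thesis
      by (simp add: cover_multiplicity_def Bs(1))
  qed
  have "inj_on code {..<n}"
  proof (rule inj_onI, rule ccontr)
    fix u v
    assume "u \<in> {..<n}" "v \<in> {..<n}" "code u = code v" "u \<noteq> v"
    with dist[of u v] \<open>0 \<notin> K\<close> show False
      by simp
  qed
  then have "card (code ` {..<n}) = n"
    by (simp add: card_image)
  moreover have "code ` {..<n} \<subseteq> Pow {..<d}"
    by (auto simp: code_def)
  moreover have "card (sym_diff A B) \<in> K"
    if "A \<in> code ` {..<n}" "B \<in> code ` {..<n}" "A \<noteq> B" for A B
    using that dist by blast
  ultimately show thesis
    using that by blast
qed

section \<open>The binomial inequality\<close>

lemma sum_choose_Suc:
  "(\<Sum>i\<le>Suc j. Suc d choose i) = (\<Sum>i\<le>Suc j. d choose i) + (\<Sum>i\<le>j. d choose i)"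
proof -
  have "(\<Sum>i\<le>Suc j. Suc d choose i) = 1 + (\<Sum>i\<le>j. Suc d choose Suc i)"
    by (subst sum.atMost_Suc_shift) simp
  also have "\<dots> = 1 + (\<Sum>i\<le>j. d choose Suc i) + (\<Sum>i\<le>j. d choose i)"
    by (simp add: sum.distrib)
  also have "1 + (\<Sum>i\<le>j. d choose Suc i) = (\<Sum>i\<le>Suc j. d choose i)"
    by (subst sum.atMost_Suc_shift) simp
  finally show ?thesis .
qed

lemma sum_choose_le_power: "(\<Sum>i\<le>j. d choose i) \<le> 2 ^ d"
proof -
  have "(\<Sum>i\<le>j. d choose i) \<le> (\<Sum>i\<le>j + d. d choose i)"
    by (rule sum_mono2) auto
  also have "\<dots> = (\<Sum>i\<le>d. d choose i)"
    by (rule sum.mono_neutral_right) auto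
  finally show ?thesis
    by (simp add: choose_row_sum)
qed

text \<open>The bound is compared for \<open>k = Suc j\<close> and \<open>d = Suc e\<close>, without the final \<open>- 1\<close>, so that the
  inequality is strict and free of truncated subtraction. Induction on \<open>j\<close>, then on \<open>e\<close>,
  follows Pascal's rule.\<close>

lemma sum_choose_less:
  "(\<Sum>i\<le>Suc j. Suc e choose i)
    < 2 ^ j * (Suc e choose Suc j) + 2 ^ j * (e choose Suc j) + 2 ^ Suc j"
proof (induction j arbitrary: e)
  case 0
  then show ?case
    by simp
next
  case (Suc j)
  note less_j = Suc.IH
  show ?case
  proof (induction e)
    case 0
    have "(\<Sum>i\<le>Suc (Suc j). Suc 0 choose i) \<le> 2"
      using sum_choose_le_power[of "Suc 0" "Suc (Suc j)"] by simp
    also have "\<dots> < (2::nat) ^ Suc (Suc j)"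
      using one_less_power[of "2::nat" "Suc j"] by simp
    finally show ?case
      by simp
  next
    case (Suc e)
    show ?case
    proof (cases "j < e")
      case True
      \<comment> \<open>Passing to \<open>Suc e\<close> adds \<open>2 ^ Suc j * ?b\<close> to the right-hand side. As \<open>?b \<ge> 2\<close>, half of
        this already absorbs the summand \<open>2 ^ Suc j\<close> of the bound for \<open>j\<close>.\<close>
      have pos: "0 < Suc e choose Suc j" "0 < e choose Suc j"
        using True by auto
      let ?b = "(Suc e choose Suc j) + (e choose Suc j)"
      have "2 ^ j * 2 \<le> 2 ^ j * ?b"
        by (rule mult_left_mono) (use pos in linarith)+
      moreover have "(\<Sum>i\<le>Suc j. Suc e choose i) < 2 ^ j * ?b + 2 ^ j * 2"
        using less_j[of e] by (simp only: distrib_left power_Suc2)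
      ultimately have "(\<Sum>i\<le>Suc j. Suc e choose i) < 2 ^ j * ?b + 2 ^ j * ?b"
        by (rule less_le_trans[OF _ add_left_mono, rotated])
      then have "(\<Sum>i\<le>Suc j. Suc e choose i) < 2 ^ Suc j * ?b"
        by (simp only: power_Suc mult_2 distrib_right)
      moreover have "2 ^ Suc j * (Suc (Suc e) choose Suc (Suc j)) + 2 ^ Suc j * (Suc e choose Suc (Suc j))
          = 2 ^ Suc j * (Suc e choose Suc (Suc j)) + 2 ^ Suc j * (e choose Suc (Suc j)) + 2 ^ Suc j * ?b"
        by (simp add: algebra_simps)
      ultimately show ?thesis
        using Suc.IH unfolding sum_choose_Suc[of "Suc e" "Suc j"] by linarith
    next
      \<comment> \<open>Here \<open>d \<le> k\<close>, so the left-hand side is at most \<open>2 ^ d \<le> 2 ^ k\<close>; strictness for \<open>d = k\<close>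
        comes from the summand with \<open>d choose k = 1\<close>.\<close>
      case False
      show ?thesis
      proof (cases "e = j")
        case True
        have "(\<Sum>i\<le>Suc (Suc j). Suc (Suc e) choose i) \<le> 2 ^ Suc (Suc j)"
          using sum_choose_le_power[of "Suc (Suc e)" "Suc (Suc j)"] by (simp only: True)
        also have "\<dots> < 2 ^ Suc j + 2 ^ Suc (Suc j)"
          by simp
        finally show ?thesis
          using True by (simp del: sum.atMost_Suc)
      next
        case neq: False
        then have "(2::nat) ^ Suc (Suc e) < 2 ^ Suc (Suc j)"
          using False by (intro power_strict_increasing) auto
        with sum_choose_le_power[of "Suc (Suc e)" "Suc (Suc j)"] show ?thesis
          by linarith
      qed
    qed
  qed
qed

section \<open>Regular covers of complete graphs\<close>

theorem theorem2:
  fixes d k :: nat and K :: "nat set"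
  assumes "d \<ge> 1"
    and "k \<ge> 1"
    and "finite K"
    and "card K = k"
    and "\<forall>m\<in>K. m > 0"
  shows "n_r K d \<le> 2 ^ (k - 1) * (d choose k) + 2 ^ (k - 1) * ((d - 1) choose k) + 2 ^ k - 1"
proof -
  have "0 \<notin> K"
    using assms(5) by auto
  obtain F where "F \<subseteq> Pow {..<d}" "card F = n_r K d"
    "\<And>A B. A \<in> F \<Longrightarrow> B \<in> F \<Longrightarrow> A \<noteq> B \<Longrightarrow> card (sym_diff A B) \<in> K"
    using regular_cover_few_distances[OF n_r_attained \<open>0 \<notin> K\<close>] by blast
  then have "n_r K d \<le> (\<Sum>i\<le>k. d choose i)"
    using few_distances_bound[of "{..<d}" F K] \<open>finite K\<close> \<open>0 \<notin> K\<close> \<open>card K = k\<close> by simp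
  moreover have "(\<Sum>i\<le>k. d choose i)
      < 2 ^ (k - 1) * (d choose k) + 2 ^ (k - 1) * ((d - 1) choose k) + 2 ^ k"
    using sum_choose_less[where j = "k - 1" and e = "d - 1"] \<open>d \<ge> 1\<close> \<open>k \<ge> 1\<close> by simp
  ultimately show ?thesis
    by linarith
qed

end
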